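(* Let $r \ge 1$ be an integer and let $w$ be a binary word with $r$ letters. Then $$\lim_{k \to \infty} \sum_{\substack{n \geq 1 \\ a_w(n) = k}} \frac{1}{n} = 2^r \log 2,$$ where $a_w(n)$ is the number of (possibly overlapping) occurrences of $w$ in the binary expansion of $n$.
   Context: A binary word is a finite string of letters in $\{0,1\}$. For a binary word $w$ and an integer $n \ge 1$, $a_w(n)$ denotes the number of occurrences of $w$ as a block of consecutive digits (overlapping occurrences are all counted) in the binary expansion of $n$, with the following convention. If $w$ begins with $0$ and is not of the form $0^{\ell}$ (the word consisting of $\ell$ digits all equal to $0$), the binary expansion of $n$ is taken to begin with an arbitrarily long prefix of $0$'s. If $w = 0^{\ell}$, the usual binary expansion of $n$ beginning with $1$ is used. (If $w$ begins with $1$, leading zeros make no difference.) For example, $a_{01}(5) = 2$ since $5$ is written $0\cdots0101$, and $a_{000}(8) = 1$ since $8$ is written $1000$. The inner sum runs over all integers $n \ge 1$ with $a_w(n) = k$. $\log$ is the natural logarithm. *)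

theory Defs
  imports "HOL-Analysis.Analysis"
begin

(* Most significant digit first, no leading zeros; the expansion of 0 is the empty list. *)
fun bin_digits :: "nat \<Rightarrow> nat list" where
  "bin_digits n = (if n = 0 then [] else bin_digits (n div 2) @ [n mod 2])"

declare bin_digits.simps [simp del]

definition occurrences :: "nat list \<Rightarrow> nat list \<Rightarrow> nat" where
  "occurrences w x =
     card {i. i + length w \<le> length x \<and> take (length w) (drop i x) = w}"

(* A word that begins with 0 and is not a power of 0 is counted in the expansion preceded by
   arbitrarily many zeros. As an occurrence of such a word must reach the leading 1, length w
   zeros already give the full count: see occurrences_padding. *)
definition block_count :: "nat list \<Rightarrow> nat \<Rightarrow> nat" where
  "block_count w n =
     (if w \<noteq> [] \<and> hd w = 0 \<and> w \<noteq> replicate (length w) 0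
      then occurrences w (replicate (length w) 0 @ bin_digits n)
      else occurrences w (bin_digits n))"

lemma occurrences_Cons_zero:
  assumes "w \<noteq> replicate (length w) 0" and "length w \<le> m"
  shows "occurrences w (0 # replicate m 0 @ x) = occurrences w (replicate m 0 @ x)"
proof -
  let ?A = "\<lambda>y. {i. i + length w \<le> length y \<and> take (length w) (drop i y) = w}"
  let ?y = "replicate m (0::nat) @ x"
  have "?A (0 # ?y) = Suc ` ?A ?y"
  proof (intro set_eqI iffI)
    fix i assume i: "i \<in> ?A (0 # ?y)"
    have "i \<noteq> 0"
    proof
      assume "i = 0"
      with i have "take (length w) (replicate (Suc m) 0 @ x) = w" by simp
      then have "replicate (length w) 0 = w"
        using assms(2) by (simp add: min_def del: replicate_Suc split: if_splits)
      with assms(1) show False by simp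
    qed
    then obtain j where "i = Suc j" by (cases i) auto
    with i show "i \<in> Suc ` ?A ?y" by auto
  qed auto
  then show ?thesis by (simp add: occurrences_def card_image)
qed

lemma occurrences_padding:
  assumes "w \<noteq> replicate (length w) 0" and "length w \<le> m"
  shows "occurrences w (replicate m 0 @ x) = occurrences w (replicate (length w) 0 @ x)"
  using assms(2)
proof (induction m rule: dec_induct)
  case (step m)
  then show ?case using occurrences_Cons_zero[OF assms(1), of m x] by simp
qed simp

lemma "block_count [0, 1] 5 = 2"
proof -
  have *: "bin_digits 5 = [1, 0, 1]"
    by (simp add: bin_digits.simps)
  have "{i. i + 2 \<le> length [0,0,1,0,1::nat] \<and> take 2 (drop i [0,0,1,0,1::nat]) = [0,1]} = {1, 3}"
    (is "?A = _")
  proof -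
    have "i \<in> ?A \<longleftrightarrow> i \<in> {1, 3}" for i
    proof -
      consider "i = 0" | "i = 1" | "i = 2" | "i = 3" | "i > 3" by linarith
      then show ?thesis by cases auto
    qed
    then show ?thesis by blast
  qed
  then show ?thesis
    by (simp add: block_count_def occurrences_def * numeral_2_eq_2)
qed

lemma "block_count [0, 0, 0] 8 = 1"
proof -
  have *: "bin_digits 8 = [1, 0, 0, 0]"
    by (simp add: bin_digits.simps)
  have "{i. i + 3 \<le> length [1,0,0,0::nat] \<and> take 3 (drop i [1,0,0,0::nat]) = [0,0,0]} = {1}"
    (is "?A = _")
  proof -
    have "i \<in> ?A \<longleftrightarrow> i \<in> {1}" for i
    proof -
      consider "i = 0" | "i = 1" | "i > 1" by linarith
      then show ?thesis by cases auto
    qed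
    then show ?thesis by blast
  qed
  then show ?thesis
    by (simp add: block_count_def occurrences_def * numeral_3_eq_3)
qed

end

theory Submission
  imports Defs
begin

text \<open>
  Write \<open>a n\<close> for the number of occurrences of \<open>w\<close> in \<open>n\<close>, and let \<open>v < 2 ^ r\<close> be the number whose
  \<open>r\<close>-digit expansion is \<open>w\<close>. Appending a last digit creates at most one new occurrence, so for
  \<open>m \<ge> 2\<close> the value \<open>a m\<close> is \<open>a (m div 2)\<close>, plus \<open>1\<close> if \<open>m\<close> is congruent to \<open>v\<close> modulo \<open>2 ^ r\<close>
  (\<open>block_count_step\<close>; the conventions on leading zeros are what makes this hold for every \<open>w\<close>).
  Only this recursion matters from then on.

  The weight \<open>g n = ln ((n + 1) / n)\<close> is within \<open>1 / n ^ 2\<close> of \<open>1 / n\<close> and satisfies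
  \<open>g n = g (2 * n) + g (2 * n + 1)\<close>: it is conserved when \<open>n\<close> is replaced by its two children.
  Hence in the binary tree of all \<open>n \<ge> 1\<close>, whose root has weight \<open>g 1 = ln 2\<close>, all the weight that
  enters the part with \<open>a n \<le> k\<close> must leave it. It leaves through the numbers \<open>m\<close> that end in \<open>w\<close>
  and have \<open>a (m div 2) = k\<close>, so these have total weight exactly \<open>ln 2\<close> as soon as \<open>a 1 \<le> k\<close>
  (\<open>infsum_log_weight_hits\<close>). As the sum of \<open>1 / n ^ 2\<close> over \<open>a n = k\<close> tends to \<open>0\<close>, the same sum
  with weights \<open>1 / m\<close> tends to \<open>ln 2\<close> (\<open>hits_limit\<close>).

  It remains to pass from the numbers ending in \<open>w\<close> to all numbers. Let \<open>S j k\<close> be the sum of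
  \<open>1 / n\<close> over those \<open>n\<close> with \<open>a n = k\<close> that end in the first \<open>j\<close> digits of \<open>w\<close>. Deleting the last
  digit shows that \<open>S (j + 1) k\<close> is about half of \<open>S j k\<close>, except that \<open>a\<close> may change under the
  deletion. This defect is either \<open>0\<close> or the difference of two consecutive terms of the sequence in
  \<open>hits_limit\<close>, and that sequence converges; so the defect tends to \<open>0\<close> (\<open>level_halving\<close>). Going
  down from \<open>S r k\<close>, which tends to \<open>ln 2\<close>, each step doubles the limit, and \<open>S 0 k\<close> tends to
  \<open>2 ^ r * ln 2\<close>.
\<close>

section \<open>Appending a digit\<close>

lemma bin_digits_step: "m \<ge> 1 \<Longrightarrow> bin_digits m = bin_digits (m div 2) @ [m mod 2]"
  by (subst bin_digits.simps) simp

lemma set_bin_digits: "set (bin_digits n) \<subseteq> {0, 1}"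
  by (induction n rule: bin_digits.induct) (subst bin_digits.simps, auto)

lemma occurrences_snoc:
  assumes "w \<noteq> []"
  shows "occurrences w (x @ [b]) = occurrences w x +
    (if length w \<le> Suc (length x) \<and> drop (Suc (length x) - length w) (x @ [b]) = w
     then 1 else 0)"
proof -
  let ?A = "{i. i + length w \<le> length x \<and> take (length w) (drop i x) = w}"
  let ?B = "{i. i + length w \<le> length (x @ [b]) \<and> take (length w) (drop i (x @ [b])) = w}"
  let ?i = "Suc (length x) - length w"
  let ?P = "length w \<le> Suc (length x) \<and> drop ?i (x @ [b]) = w"
  have fin: "finite ?A"
    by (rule finite_subset[of _ "{..length x}"]) auto
  have "i \<in> ?B \<longleftrightarrow> i \<in> ?A \<or> i = ?i \<and> ?P" for i
  proof (cases "i + length w \<le> length x")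
    case True
    then have "i \<noteq> ?i" "take (length w) (drop i (x @ [b])) = take (length w) (drop i x)"
      by auto
    with True show ?thesis by auto
  next
    case False
    show ?thesis
    proof (cases "i + length w = Suc (length x)")
      case True
      then have "i = ?i" "length w \<le> Suc (length x)" by auto
      moreover from this have "take (length w) (drop i (x @ [b])) = drop ?i (x @ [b])"
        by simp
      ultimately show ?thesis using False True by auto
    qed (use False in auto)
  qed
  then have "?B = (if ?P then insert ?i ?A else ?A)"
    by auto
  moreover have "?i \<notin> ?A" using assms by (cases w) auto
  ultimately show ?thesis
    using fin by (simp add: occurrences_def)
qed

definition bin_value :: "nat list \<Rightarrow> nat" where
  "bin_value = foldl (\<lambda>s d. 2 * s + d) 0"

lemma bin_value_Nil [simp]: "bin_value [] = 0"
  and bin_value_snoc [simp]: "bin_value (x @ [d]) = 2 * bin_value x + d"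
  by (simp_all add: bin_value_def)

lemma bin_value_append: "bin_value (x @ y) = bin_value x * 2 ^ length y + bin_value y"
proof (induction y rule: rev_induct)
  case (snoc d y)
  have "bin_value (x @ y @ [d]) = 2 * bin_value (x @ y) + d"
    using bin_value_snoc[of "x @ y" d] by simp
  then show ?case using snoc by simp
qed simp

lemma bin_value_replicate_0 [simp]: "bin_value (replicate m 0) = 0"
  by (induction m) (simp_all flip: replicate_append_same)

lemma bin_value_bin_digits [simp]: "bin_value (bin_digits n) = n"
proof (induction n rule: less_induct)
  case (less n)
  show ?case
  proof (cases "n = 0")
    case True
    then show ?thesis by (simp add: bin_digits.simps)
  next
    case False
    then show ?thesis using less[of "n div 2"] by (simp add: bin_digits_step)
  qed
qed

lemma bin_value_less: "set x \<subseteq> {0, 1} \<Longrightarrow> bin_value x < 2 ^ length x"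
  by (induction x rule: rev_induct) auto

lemma bin_value_inject:
  assumes "length x = length y" "set x \<subseteq> {0, 1}" "set y \<subseteq> {0, 1}" "bin_value x = bin_value y"
  shows "x = y"
  using assms
proof (induction x arbitrary: y rule: rev_induct)
  case (snoc d x)
  from snoc.prems(1) obtain z e where y: "y = z @ [e]"
    by (cases y rule: rev_cases) auto
  have "2 * bin_value x + d = 2 * bin_value z + e" "d \<in> {0, 1}" "e \<in> {0, 1}"
    using snoc.prems y by auto
  then have "bin_value x = bin_value z \<and> d = e" by (elim insertE emptyE) presburger+
  with snoc y show ?case by auto
qed simp

lemma suffix_eq_iff_mod:
  assumes "set w \<subseteq> {0, 1}" "set y \<subseteq> {0, 1}" "length w \<le> length y"
  shows "drop (length y - length w) y = w \<longleftrightarrow> bin_value y mod 2 ^ length w = bin_value w"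
proof -
  let ?s = "drop (length y - length w) y"
  have len: "length ?s = length w" using assms by simp
  have set: "set ?s \<subseteq> {0, 1}" using assms set_drop_subset by fast
  have "bin_value y = bin_value (take (length y - length w) y) * 2 ^ length w + bin_value ?s"
    using bin_value_append[of "take (length y - length w) y" ?s] len by simp
  then have "bin_value y mod 2 ^ length w = bin_value ?s"
    using bin_value_less[OF set] len by simp
  then show ?thesis
    using bin_value_inject[OF len set assms(1)] by auto
qed

text \<open>
  When the digits of \<open>m\<close> (with padding, if there is any) are at least as many as those of \<open>w\<close>, the
  new occurrence is read off from the last digits. Otherwise there is none, and the residue of
  \<open>m\<close> is \<open>m\<close> itself: it differs from the value of \<open>w\<close>, which is at least \<open>2 ^ (length w - 1) > m\<close> if
  \<open>w\<close> begins with \<open>1\<close>, and is \<open>0\<close> if \<open>w\<close> is a power of \<open>0\<close>.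
\<close>

lemma block_count_step:
  assumes w: "set w \<subseteq> {0, 1}" "w \<noteq> []" and m: "m \<ge> 2"
  shows "block_count w m = block_count w (m div 2) +
    (if m mod 2 ^ length w = bin_value w then 1 else 0)"
proof -
  let ?y = "bin_digits (m div 2)"
  let ?r = "length w"
  have ym: "bin_digits m = ?y @ [m mod 2]" using m by (simp add: bin_digits_step)
  show ?thesis
  proof (cases "hd w = 0 \<and> w \<noteq> replicate ?r 0")
    case True
    let ?x = "replicate ?r 0 @ ?y"
    have "set (?x @ [m mod 2]) \<subseteq> {0, 1}"
      using set_bin_digits[of "m div 2"] by auto
    moreover have "bin_value (?x @ [m mod 2]) = m"
      using bin_value_append[of "replicate ?r 0" "?y @ [m mod 2]"] by simp
    ultimately have "drop (Suc (length ?x) - ?r) (?x @ [m mod 2]) = w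
      \<longleftrightarrow> m mod 2 ^ ?r = bin_value w"
      using suffix_eq_iff_mod[OF w(1), of "?x @ [m mod 2]"]
      by (simp del: append_assoc drop_append)
    then show ?thesis
      using True w occurrences_snoc[OF w(2), of ?x "m mod 2"]
      by (auto simp: block_count_def ym)
  next
    case False
    have "?r \<le> Suc (length ?y) \<and> drop (Suc (length ?y) - ?r) (?y @ [m mod 2]) = w
      \<longleftrightarrow> m mod 2 ^ ?r = bin_value w"
    proof (cases "?r \<le> Suc (length ?y)")
      case True
      have "set (?y @ [m mod 2]) \<subseteq> {0, 1}"
        using set_bin_digits[of "m div 2"] by auto
      from suffix_eq_iff_mod[OF w(1) this] True show ?thesis by simp
    next
      case short: False
      have "m < 2 ^ length (bin_digits m)"
        using bin_value_less[OF set_bin_digits[of m]] by simp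
      also have "\<dots> \<le> 2 ^ (?r - 1)"
        using short ym by (intro power_increasing) auto
      finally have less: "m < 2 ^ (?r - 1)" .
      also have "\<dots> \<le> 2 ^ ?r" by (intro power_increasing) auto
      finally have mod: "m mod 2 ^ ?r = m" by simp
      from \<open>w \<noteq> []\<close> obtain d u where wu: "w = d # u" by (cases w) auto
      have "bin_value w \<noteq> m"
      proof (cases "d = 0")
        case True
        then have "w = replicate ?r 0" using False wu by auto
        then have "bin_value w = 0" by (metis bin_value_replicate_0)
        then show ?thesis using m by simp
      next
        case False
        then have "d = 1" using w wu by auto
        then have "bin_value w \<ge> 2 ^ (?r - 1)"
          using bin_value_append[of "[d]" u] wu by (simp add: bin_value_def)
        with less show ?thesis by simp
      qed
      with mod short show ?thesis by simp
    qed
    then show ?thesis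
      using False occurrences_snoc[OF w(2), of ?y "m mod 2"]
      by (auto simp: block_count_def ym)
  qed
qed

section \<open>Logarithmic weights\<close>

definition log_weight :: "nat \<Rightarrow> real" where
  "log_weight n = ln (1 + 1 / real n)"

lemma log_weight_nonneg: "log_weight n \<ge> 0"
  by (simp add: log_weight_def)

text \<open>
  The interval from \<open>n\<close> to \<open>n + 1\<close> has logarithmic length \<open>log_weight n\<close>; scaled by \<open>2\<close> it is cut
  in two at \<open>2 * n + 1\<close>.
\<close>

lemma log_weight_split:
  assumes "n \<ge> 1"
  shows "log_weight n = log_weight (2 * n) + log_weight (2 * n + 1)"
proof -
  have "1 + 1 / real n = (1 + 1 / real (2 * n)) * (1 + 1 / real (2 * n + 1))"
    using assms by (simp add: divide_simps) (simp add: algebra_simps)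
  moreover have "1 + 1 / real (2 * n) > 0" "1 + 1 / real (2 * n + 1) > 0"
    by (auto intro!: add_pos_nonneg)
  ultimately show ?thesis
    unfolding log_weight_def by (simp add: ln_mult)
qed

lemma log_weight_bounds:
  assumes "n \<ge> 1"
  shows "log_weight n \<le> 1 / real n" "1 / real n - 1 / real n ^ 2 \<le> log_weight n"
    "1 / real n \<le> 2 * log_weight n"
proof -
  let ?x = "1 / real n"
  have x: "?x > 0" "?x \<le> 1" using assms by auto
  show "log_weight n \<le> ?x"
    unfolding log_weight_def using x by (intro ln_add_one_self_le_self) auto
  have "- ln (1 + ?x) = ln (1 / (1 + ?x))" using x by (simp add: ln_div)
  also have "\<dots> \<le> 1 / (1 + ?x) - 1"
    using x by (intro ln_le_minus_one) (auto intro: divide_pos_pos add_pos_pos)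
  finally have lb: "log_weight n \<ge> 1 - 1 / (1 + ?x)" by (simp add: log_weight_def)
  have "1 - 1 / (1 + ?x) = 1 / (real n + 1)" using assms by (simp add: field_simps)
  then have lb: "log_weight n \<ge> 1 / (real n + 1)" using lb by simp
  have "?x - ?x ^ 2 \<le> 1 / (real n + 1)"
    using assms by (simp add: divide_simps power2_eq_square) (simp add: algebra_simps)
  with lb show "?x - 1 / real n ^ 2 \<le> log_weight n" by (simp add: power_one_over)
  have "?x \<le> 2 * (1 / (real n + 1))" using assms by (simp add: field_simps)
  with lb show "?x \<le> 2 * log_weight n" by simp
qed

lemma sum_log_weight_halves:
  "(\<Sum>n\<in>{n\<in>{1..<M}. P n}. log_weight n) = (\<Sum>m\<in>{m\<in>{2..<2*M}. P (m div 2)}. log_weight m)"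
proof -
  let ?A = "{n\<in>{1..<M}. P n}"
  have eq: "{m\<in>{2..<2*M}. P (m div 2)} = (\<lambda>n. 2 * n) ` ?A \<union> (\<lambda>n. 2 * n + 1) ` ?A" (is "?L = ?R")
  proof (intro equalityI subsetI)
    fix m assume m: "m \<in> ?L"
    then have "m div 2 \<in> ?A" by auto
    moreover have "m = 2 * (m div 2) \<or> m = 2 * (m div 2) + 1" by presburger
    ultimately show "m \<in> ?R" by blast
  qed auto
  have "(\<lambda>n. 2 * n) ` ?A \<inter> (\<lambda>n. 2 * n + 1) ` ?A = {}"
    using double_not_eq_Suc_double by (auto simp: image_iff)
  then have "(\<Sum>m\<in>?L. log_weight m)
      = (\<Sum>m\<in>(\<lambda>n. 2 * n) ` ?A. log_weight m) + (\<Sum>m\<in>(\<lambda>n. 2 * n + 1) ` ?A. log_weight m)"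
    unfolding eq by (intro sum.union_disjoint) auto
  also have "\<dots> = (\<Sum>n\<in>?A. log_weight (2 * n)) + (\<Sum>n\<in>?A. log_weight (2 * n + 1))"
    by (simp add: sum.reindex inj_on_def)
  also have "\<dots> = (\<Sum>n\<in>?A. log_weight n)"
    unfolding sum.distrib[symmetric] by (intro sum.cong refl log_weight_split[symmetric]) simp
  finally show ?thesis by simp
qed

section \<open>Infinite sums over sets of integers\<close>

lemma partial_sums_tendsto_infsum:
  fixes f :: "nat \<Rightarrow> real"
  assumes "f summable_on A"
  shows "(\<lambda>M. \<Sum>n\<in>A \<inter> {..<M}. f n) \<longlonglongrightarrow> infsum f A"
proof -
  let ?h = "\<lambda>n. if n \<in> A then f n else 0"
  have "(f has_sum infsum f A) A" using assms by (rule has_sum_infsum)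
  then have "(?h has_sum infsum f A) UNIV"
    by (rule has_sum_cong_neutral[THEN iffD1, rotated -1]) auto
  then have "?h sums infsum f A" by (rule has_sum_imp_sums)
  then have "(\<lambda>M. \<Sum>n<M. ?h n) \<longlonglongrightarrow> infsum f A" by (simp add: sums_def)
  moreover have "(\<Sum>n<M. ?h n) = (\<Sum>n\<in>A \<inter> {..<M}. f n)" for M
    by (subst Int_commute, subst sum.inter_restrict) auto
  ultimately show ?thesis by simp
qed

lemma inverse_squares_summable_on: "(\<lambda>n. 1 / real n ^ 2) summable_on A"
proof -
  have "summable (\<lambda>n. 1 / real n ^ 2)"
    using inverse_power_summable[of 2, where 'a = real] by (simp add: inverse_eq_divide)
  then have "(\<lambda>n. 1 / real n ^ 2) summable_on UNIV"
    by (intro norm_summable_imp_summable_on) simp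
  then show ?thesis by (rule summable_on_subset_banach) simp
qed

text \<open>
  The fibres of \<open>a\<close> partition a convergent series, so their sums form a convergent series.
  This bounds every error made by exchanging weights that agree up to \<open>1 / n ^ 2\<close>.
\<close>

lemma fibre_sums_of_squares_tendsto_0:
  fixes a :: "nat \<Rightarrow> nat"
  shows "(\<lambda>k. \<Sum>\<^sub>\<infinity>n | a n = k. 1 / real n ^ 2) \<longlonglongrightarrow> 0"
proof -
  let ?f = "\<lambda>n. 1 / real n ^ 2"
  let ?S = "SIGMA k:UNIV. {n. a n = k}"
  have "bij_betw (\<lambda>n. (a n, n)) UNIV ?S"
    by (rule bij_betwI[where g = snd]) auto
  then have "(\<lambda>(k, n). ?f n) summable_on ?S"
    using summable_on_reindex_bij_betw[of "\<lambda>n. (a n, n)" UNIV ?S "\<lambda>(k, n). ?f n"]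
      inverse_squares_summable_on[of UNIV] by simp
  then have "(\<lambda>k. \<Sum>\<^sub>\<infinity>n | a n = k. ?f n) summable_on UNIV"
    by (rule summable_on_Sigma_banach)
  then show ?thesis
    by (intro summable_LIMSEQ_zero summable_on_imp_summable)
qed

section \<open>Counters driven by a residue class\<close>

locale residue_counter =
  fixes a :: "nat \<Rightarrow> nat" and r v :: nat
  assumes step: "\<And>m. m \<ge> 2 \<Longrightarrow> a m = a (m div 2) + (if m mod 2 ^ r = v then 1 else 0)"
    and v_less: "v < 2 ^ r"
begin

text \<open>
  For \<open>v\<close> written with \<open>r\<close> digits, the number formed by the first \<open>j\<close> of them.
\<close>

definition lead :: "nat \<Rightarrow> nat" where
  "lead j = v div 2 ^ (r - j)"

definition level :: "nat \<Rightarrow> nat \<Rightarrow> nat set" where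
  "level j k = {n. n \<ge> 1 \<and> n mod 2 ^ j = lead j \<and> a n = k}"

text \<open>
  The counterpart of \<open>level\<close> in which the count is taken before the last digit. Thus \<open>below r k\<close>
  consists of the numbers at which the counter passes from \<open>k\<close> to \<open>Suc k\<close>, called hits in what
  follows.
\<close>

definition below :: "nat \<Rightarrow> nat \<Rightarrow> nat set" where
  "below j k = {m. m \<ge> 2 \<and> m mod 2 ^ j = lead j \<and> a (m div 2) = k}"

lemma lead_0 [simp]: "lead 0 = 0"
  using v_less by (simp add: lead_def)

lemma lead_r [simp]: "lead r = v"
  by (simp add: lead_def)

lemma lead_Suc_div_2: "j < r \<Longrightarrow> lead (Suc j) div 2 = lead j"
  unfolding lead_def
  by (metis Suc_diff_Suc div_mult2_eq power_Suc2)

lemma below_Suc: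
  assumes "j < r"
  shows "below (Suc j) k = (\<lambda>n. 2 * n + lead (Suc j) mod 2) ` level j k"
proof -
  let ?b = "lead (Suc j) mod 2"
  have mod: "m mod 2 ^ Suc j = 2 * (m div 2 mod 2 ^ j) + m mod 2" for m :: nat
    by (simp add: mod_mult2_eq)
  have digit: "x = y \<and> p mod 2 = q mod 2" if "2 * x + p mod 2 = 2 * y + q mod 2"
    for x y p q :: nat
    using that by presburger
  have lead: "lead (Suc j) = 2 * lead j + ?b"
    using lead_Suc_div_2[OF assms] by presburger
  have iff: "m mod 2 ^ Suc j = lead (Suc j) \<longleftrightarrow> m div 2 mod 2 ^ j = lead j \<and> m mod 2 = ?b" for m
  proof
    assume "m mod 2 ^ Suc j = lead (Suc j)"
    then have "2 * (m div 2 mod 2 ^ j) + m mod 2 = 2 * lead j + ?b" using mod lead by simp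
    then show "m div 2 mod 2 ^ j = lead j \<and> m mod 2 = ?b"
      using digit by blast
  qed (use mod lead in simp)
  show ?thesis
  proof (intro equalityI subsetI)
    fix m assume "m \<in> below (Suc j) k"
    then have "m div 2 \<in> level j k" "m mod 2 = ?b"
      unfolding below_def level_def iff by auto
    then show "m \<in> (\<lambda>n. 2 * n + ?b) ` level j k"
      by (intro image_eqI[of _ _ "m div 2"]) presburger+
  next
    fix m assume "m \<in> (\<lambda>n. 2 * n + ?b) ` level j k"
    then obtain n where n: "n \<in> level j k" "m = 2 * n + ?b" by blast
    then have "m div 2 = n" "m mod 2 = ?b" by simp_all
    with n show "m \<in> below (Suc j) k"
      unfolding below_def level_def iff by auto
  qed
qed

lemma a_below_r: "m \<in> below r k \<Longrightarrow> a m = Suc k"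
  by (simp add: below_def step)

text \<open>
  Conservation of weight, cut off at \<open>2 * M\<close>. The children of the \<open>n < M\<close> in \<open>C\<close> carry the same
  weight as these \<open>n\<close>, and each child is either in \<open>C\<close> again or a hit. As \<open>a\<close> does not decrease
  from a number to its children, all members of \<open>C\<close> below \<open>2 * M\<close> arise as such children, except
  the root \<open>1\<close>, of weight \<open>ln 2\<close>.
\<close>

lemma hit_balance:
  fixes k M :: nat
  defines "C \<equiv> {n. n \<ge> 1 \<and> a n \<le> k}"
  assumes "M \<ge> 1"
  shows "(\<Sum>n\<in>below r k \<inter> {..<2*M}. log_weight n) =
    (\<Sum>n\<in>C \<inter> {..<M}. log_weight n) - (\<Sum>n\<in>C \<inter> {..<2*M}. log_weight n)
    + (if a 1 \<le> k then ln 2 else 0)"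
proof -
  let ?g = "sum log_weight"
  let ?D = "{m\<in>{2..<2*M}. a m \<le> k}"
  have CM: "C \<inter> {..<M} = {n\<in>{1..<M}. a n \<le> k}"
    by (auto simp: C_def)
  have "{m\<in>{2..<2*M}. a (m div 2) \<le> k} = ?D \<union> (below r k \<inter> {..<2*M})"
    by (auto simp: below_def step split: if_splits)
  moreover have "?D \<inter> (below r k \<inter> {..<2*M}) = {}"
    using a_below_r by fastforce
  ultimately have 1: "?g (C \<inter> {..<M}) = ?g ?D + ?g (below r k \<inter> {..<2*M})"
    unfolding CM sum_log_weight_halves by (simp add: sum.union_disjoint)
  have "n \<in> C \<inter> {..<2*M} \<longleftrightarrow> n \<in> (if a 1 \<le> k then insert 1 ?D else ?D)" for n
    using assms(2) by (cases "n = 1") (auto simp: C_def)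
  then have "C \<inter> {..<2*M} = (if a 1 \<le> k then insert 1 ?D else ?D)"
    by blast
  then have 2: "?g (C \<inter> {..<2*M}) = ?g ?D + (if a 1 \<le> k then ln 2 else 0)"
    by (simp add: log_weight_def)
  from 1 2 show ?thesis by simp
qed

text \<open>
  In \<open>hit_balance\<close> the sum over \<open>C\<close> up to \<open>M\<close> is at most the sum up to \<open>2 * M\<close>, so the hits never
  weigh more than \<open>ln 2\<close>. This a priori bound is the source of all convergence statements below,
  including that of the sums over \<open>C\<close>.
\<close>

lemma log_weight_summable_on_hits: "log_weight summable_on below r k"
proof (rule nonneg_bdd_above_summable_on)
  show "bdd_above (sum log_weight ` {F. F \<subseteq> below r k \<and> finite F})"
  proof (rule bdd_aboveI2)
    fix F assume F: "F \<in> {F. F \<subseteq> below r k \<and> finite F}"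
    then obtain M where "\<forall>n\<in>F. n < M" using finite_nat_set_iff_bounded by auto
    with F have sub: "F \<subseteq> below r k \<inter> {..<2 * Suc M}" by fastforce
    let ?C = "{n. n \<ge> 1 \<and> a n \<le> k}"
    have "sum log_weight F \<le> sum log_weight (below r k \<inter> {..<2 * Suc M})"
      using sub by (intro sum_mono2) (auto simp: log_weight_nonneg)
    also have "\<dots> \<le> sum log_weight (?C \<inter> {..<Suc M}) - sum log_weight (?C \<inter> {..<2 * Suc M}) + ln 2"
      by (subst hit_balance) auto
    also have "\<dots> \<le> ln 2"
      using sum_mono2[of "?C \<inter> {..<2 * Suc M}" "?C \<inter> {..<Suc M}" log_weight]
      by (force simp: log_weight_nonneg)
    finally show "sum log_weight F \<le> ln 2" .
  qed
qed (simp add: log_weight_nonneg)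

lemma below_ge_2: "m \<in> below j k \<Longrightarrow> m \<ge> 2"
  by (simp add: below_def)

lemma level_ge_1: "n \<in> level j k \<Longrightarrow> n \<ge> 1"
  by (simp add: level_def)

abbreviation recip :: "nat \<Rightarrow> real" where
  "recip n \<equiv> 1 / real n"

lemma recip_summable_on_hits: "recip summable_on below r k"
proof (rule summable_on_comparison_test)
  show "(\<lambda>n. 2 * log_weight n) summable_on below r k"
    by (intro summable_on_cmult_right log_weight_summable_on_hits)
  show "recip n \<le> 2 * log_weight n" if "n \<in> below r k" for n
    using log_weight_bounds(3)[of n] below_ge_2[OF that] by simp
qed simp

lemma inj_append_digit: "inj_on (\<lambda>n::nat. 2 * n + b) A"
  by (auto simp: inj_on_def)

lemma recip_summable_on_level_if_below:
  assumes "j < r" "recip summable_on below (Suc j) k"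
  shows "recip summable_on level j k"
proof -
  let ?b = "lead (Suc j) mod 2"
  have "(recip \<circ> (\<lambda>n. 2 * n + ?b)) summable_on level j k"
    using assms(2) unfolding below_Suc[OF assms(1)]
    by (subst (asm) summable_on_reindex) (auto simp: inj_append_digit)
  \<comment> \<open>The factor \<open>3\<close> serves because \<open>2 * n + b \<le> 3 * n\<close> for a digit \<open>b\<close> and \<open>n \<ge> 1\<close>.\<close>
  then have "(\<lambda>n. 3 * recip (2 * n + ?b)) summable_on level j k"
    by (intro summable_on_cmult_right) (simp add: o_def)
  then show ?thesis
  proof (rule summable_on_comparison_test)
    fix n assume "n \<in> level j k"
    then have "n \<ge> 1" by (rule level_ge_1)
    moreover have "?b \<le> 1" by presburger
    ultimately have "2 * n + ?b \<le> 3 * n" "2 * n + ?b > 0" by linarith+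
    then have "real (2 * n + ?b) \<le> 3 * real n" "real (2 * n + ?b) > 0"
      by linarith+
    then show "recip n \<le> 3 * recip (2 * n + ?b)"
      using \<open>n \<ge> 1\<close> by (simp only: divide_simps) (simp add: algebra_simps)
  qed simp
qed

lemma below_subset: "below j k \<subseteq> level j k \<union> below r k"
proof
  fix m assume "m \<in> below j k"
  then show "m \<in> level j k \<union> below r k"
    using step[of m] by (cases "m mod 2 ^ r = v") (auto simp: below_def level_def)
qed

text \<open>
  Deleting the last digit carries summability from \<open>below (Suc j) k\<close> to \<open>level j k\<close>, and
  \<open>below_subset\<close> carries it from \<open>level j k\<close> to \<open>below j k\<close>. Starting with the hits, this descends
  to every \<open>j < r\<close>; the case \<open>j = 0\<close> concerns all \<open>n\<close> with \<open>a n = k\<close>.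
\<close>

lemma recip_summable_on_level:
  assumes "j < r"
  shows "recip summable_on level j k"
  using assms
proof (induction rule: strict_inc_induct)
  case (base j)
  then show ?case
    using recip_summable_on_level_if_below[of j k] recip_summable_on_hits by simp
next
  case (step j)
  have "recip summable_on (level (Suc j) k \<union> below r k)"
    using step by (intro summable_on_union recip_summable_on_hits)
  then have "recip summable_on below (Suc j) k"
    by (rule summable_on_subset_banach) (rule below_subset)
  with step.hyps show ?case by (intro recip_summable_on_level_if_below) simp
qed

section \<open>Limits of the weights of the classes\<close>

lemma recip_summable_on:
  assumes "r \<ge> 1" "A \<subseteq> level 0 k"
  shows "recip summable_on A"
  using recip_summable_on_level[of 0 k] assms by (auto intro: summable_on_subset_banach)

lemma recip_summable_on_below: "r \<ge> 1 \<Longrightarrow> recip summable_on below j k"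
  by (rule summable_on_subset_banach[OF _ below_subset], intro summable_on_union
      recip_summable_on_hits recip_summable_on[where k = k]) (auto simp: level_def)

lemma log_weight_summable_on_le:
  assumes "r \<ge> 1"
  shows "log_weight summable_on {n. n \<ge> 1 \<and> a n \<le> k}"
proof -
  have level: "log_weight summable_on level 0 i" for i
    by (rule summable_on_comparison_test[OF recip_summable_on[OF assms order_refl, of i]])
      (auto simp: log_weight_nonneg log_weight_bounds level_def)
  show ?thesis
  proof (induction k)
    case 0
    have "{n. n \<ge> 1 \<and> a n \<le> 0} = level 0 0" by (auto simp: level_def)
    then show ?case using level[of 0] by simp
  next
    case (Suc k)
    have "{n. n \<ge> 1 \<and> a n \<le> Suc k} = {n. n \<ge> 1 \<and> a n \<le> k} \<union> level 0 (Suc k)"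
      by (auto simp: level_def)
    then show ?case using summable_on_union[OF Suc level[of "Suc k"]] by simp
  qed
qed

text \<open>
  Now that the sum over \<open>C\<close> converges, its two truncations in \<open>hit_balance\<close> cancel in the limit.
\<close>

lemma infsum_log_weight_hits:
  assumes "r \<ge> 1" "a 1 \<le> k"
  shows "(\<Sum>\<^sub>\<infinity>n\<in>below r k. log_weight n) = ln 2"
proof -
  let ?C = "{n. n \<ge> 1 \<and> a n \<le> k}"
  have double: "strict_mono (\<lambda>M::nat. 2 * M)" by (auto intro: strict_monoI)
  note lim = partial_sums_tendsto_infsum[OF log_weight_summable_on_le[OF assms(1), of k]]
  have "(\<lambda>M. sum log_weight (?C \<inter> {..<M}) - sum log_weight (?C \<inter> {..<2*M}) + ln 2)
      \<longlonglongrightarrow> infsum log_weight ?C - infsum log_weight ?C + ln 2"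
    using LIMSEQ_subseq_LIMSEQ[OF lim double] by (intro tendsto_intros lim) (simp add: o_def)
  moreover have "\<forall>\<^sub>F M in sequentially.
      sum log_weight (?C \<inter> {..<M}) - sum log_weight (?C \<inter> {..<2*M}) + ln 2
      = sum log_weight (below r k \<inter> {..<2*M})"
    using eventually_ge_at_top[of 1] by eventually_elim (use assms(2) in \<open>simp add: hit_balance\<close>)
  ultimately have "(\<lambda>M. sum log_weight (below r k \<inter> {..<2*M})) \<longlonglongrightarrow> ln 2"
    by (force dest: Lim_transform_eventually)
  moreover have "(\<lambda>M. sum log_weight (below r k \<inter> {..<2*M})) \<longlonglongrightarrow> infsum log_weight (below r k)"
    using LIMSEQ_subseq_LIMSEQ[OF partial_sums_tendsto_infsum[OF log_weight_summable_on_hits] double]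
    by (simp add: o_def)
  ultimately show ?thesis by (rule LIMSEQ_unique[symmetric])
qed

lemma infsum_diff_squares_bound:
  fixes f g :: "nat \<Rightarrow> real"
  assumes "f summable_on A" "g summable_on A"
    and "\<And>n. n \<in> A \<Longrightarrow> 0 \<le> f n - g n \<and> f n - g n \<le> 1 / real n ^ 2"
    and "A \<subseteq> {n. a n = k}"
  shows "\<bar>infsum f A - infsum g A\<bar> \<le> (\<Sum>\<^sub>\<infinity>n | a n = k. 1 / real n ^ 2)"
proof -
  have sum: "(\<lambda>n. f n - g n) summable_on A"
    using summable_on_add[OF assms(1), of "\<lambda>n. - g n"] assms(2) summable_on_uminus[of g A] by simp
  have eq: "infsum f A - infsum g A = (\<Sum>\<^sub>\<infinity>n\<in>A. f n - g n)"
    using infsum_add[OF assms(2) sum] by simp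
  have "0 \<le> (\<Sum>\<^sub>\<infinity>n\<in>A. f n - g n)" using assms by (intro infsum_nonneg) auto
  moreover have "(\<Sum>\<^sub>\<infinity>n\<in>A. f n - g n) \<le> (\<Sum>\<^sub>\<infinity>n | a n = k. 1 / real n ^ 2)"
    using assms by (intro infsum_mono_neutral sum inverse_squares_summable_on) auto
  ultimately show ?thesis using eq by simp
qed

lemma hits_limit:
  assumes "r \<ge> 1"
  shows "(\<lambda>k. infsum recip (below r k)) \<longlonglongrightarrow> ln 2"
proof (rule LIM_zero_cancel, rule Lim_null_comparison)
  show "(\<lambda>k. \<Sum>\<^sub>\<infinity>n | a n = Suc k. 1 / real n ^ 2) \<longlonglongrightarrow> 0"
    using fibre_sums_of_squares_tendsto_0 by (rule LIMSEQ_Suc)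
  show "\<forall>\<^sub>F k in sequentially. norm (infsum recip (below r k) - ln 2)
      \<le> (\<Sum>\<^sub>\<infinity>n | a n = Suc k. 1 / real n ^ 2)"
    using eventually_gt_at_top[of "a 1"]
  proof eventually_elim
    case (elim k)
    have "\<bar>infsum recip (below r k) - infsum log_weight (below r k)\<bar>
        \<le> (\<Sum>\<^sub>\<infinity>n | a n = Suc k. 1 / real n ^ 2)"
    proof (rule infsum_diff_squares_bound)
      fix n assume "n \<in> below r k"
      then have "n \<ge> 1" using below_ge_2 by force
      then show "0 \<le> recip n - log_weight n \<and> recip n - log_weight n \<le> 1 / real n ^ 2"
        using log_weight_bounds[of n] by linarith
    qed (use a_below_r in \<open>auto intro: recip_summable_on_hits log_weight_summable_on_hits\<close>)
    with elim show ?case using infsum_log_weight_hits[OF assms, of k] by simp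
  qed
qed

text \<open>
  By \<open>below_Suc\<close> both sums range over \<open>level j k\<close>, with terms \<open>1 / (2 * n)\<close> and \<open>1 / (2 * n + b)\<close>
  for a digit \<open>b\<close>.
\<close>

lemma below_half_level:
  assumes "j < r"
  shows "\<bar>infsum recip (level j k) / 2 - infsum recip (below (Suc j) k)\<bar>
    \<le> (\<Sum>\<^sub>\<infinity>n | a n = k. 1 / real n ^ 2)"
proof -
  let ?b = "lead (Suc j) mod 2"
  let ?h = "\<lambda>n. 2 * n + ?b"
  have inj: "inj_on ?h (level j k)" by (rule inj_append_digit)
  have below: "infsum recip (below (Suc j) k) = (\<Sum>\<^sub>\<infinity>n\<in>level j k. recip (?h n))"
    unfolding below_Suc[OF assms] by (simp only: infsum_reindex[OF inj] o_def)
  have half: "infsum recip (level j k) / 2 = (\<Sum>\<^sub>\<infinity>n\<in>level j k. recip n * (1/2))"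
    by (subst infsum_cmult_left') simp
  show ?thesis unfolding below half
  proof (rule infsum_diff_squares_bound)
    show "(\<lambda>n. recip n * (1/2)) summable_on level j k"
      by (intro summable_on_cmult_left recip_summable_on_level assms)
    have "recip summable_on ?h ` level j k"
      using recip_summable_on_below[of "Suc j" k] assms below_Suc[OF assms] by simp
    then show "(\<lambda>n. recip (?h n)) summable_on level j k"
      by (simp only: summable_on_reindex[OF inj] o_def)
    fix n assume "n \<in> level j k"
    then have n: "n \<ge> 1" by (rule level_ge_1)
    have "?b = 0 \<or> ?b = 1" by presburger
    then show "0 \<le> recip n * (1/2) - recip (?h n) \<and> recip n * (1/2) - recip (?h n) \<le> 1 / real n ^ 2"
    proof
      assume b: "?b = 1"
      have "recip n * (1/2) - recip (?h n) = 1 / (real n * (4 * real n + 2))"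
        unfolding b using n by (simp add: divide_simps)
      moreover have "1 / (real n * (4 * real n + 2)) \<le> 1 / (real n * real n)"
        using n by (intro divide_left_mono mult_left_mono) auto
      ultimately show ?thesis by (simp add: power2_eq_square)
    qed simp
  qed (auto simp: level_def)
qed

text \<open>
  Counting with or without the last digit differs only at hits: those that raise the count from
  \<open>k\<close> to \<open>Suc k\<close> are gained, those that raise it from \<open>Suc k\<close> to \<open>Suc (Suc k)\<close> are lost. All hits
  end in \<open>v\<close>, so either all of them or none lie in the residue class of \<open>lead j\<close>, according to
  whether the first \<open>j\<close> digits of \<open>v\<close> are also its last \<open>j\<close> digits. The number \<open>1\<close> has no parent
  and is excluded by \<open>a 1 \<noteq> Suc k\<close>.
\<close>

lemma level_vs_below:
  assumes "j \<le> r" "r \<ge> 1" "a 1 \<noteq> Suc k"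
  shows "infsum recip (level j (Suc k)) = infsum recip (below j (Suc k)) +
    (if v mod 2 ^ j = lead j
     then infsum recip (below r k) - infsum recip (below r (Suc k)) else 0)"
proof -
  define H where "H i = (if v mod 2 ^ j = lead j then below r i else {})" for i
  have mod: "m mod 2 ^ r mod 2 ^ j = m mod 2 ^ j" for m :: nat
    using assms(1) by (simp add: mod_mod_cancel le_imp_power_dvd)
  have hit: "m mod 2 ^ j = v mod 2 ^ j" if "m \<in> below r i" for m i
    using that mod[of m] by (simp add: below_def)
  have ge2: "m \<ge> 2" if "m \<in> level j (Suc k)" for m
    using that assms(3) by (cases "m = 1") (auto simp: level_def)
  \<comment> \<open>The lost hits are added on the left and the gained hits on the right.\<close>
  have eq: "level j (Suc k) \<union> H (Suc k) = below j (Suc k) \<union> H k"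
  proof (intro set_eqI iffI)
    fix m assume "m \<in> level j (Suc k) \<union> H (Suc k)"
    then show "m \<in> below j (Suc k) \<union> H k"
    proof
      assume m: "m \<in> level j (Suc k)"
      then show ?thesis
        using ge2[OF m] mod[of m] step[OF ge2[OF m]]
        by (cases "m mod 2 ^ r = v") (auto simp: level_def below_def H_def)
    qed (use hit in \<open>auto simp: H_def below_def split: if_splits\<close>)
  next
    fix m assume "m \<in> below j (Suc k) \<union> H k"
    then show "m \<in> level j (Suc k) \<union> H (Suc k)"
    proof
      assume m: "m \<in> below j (Suc k)"
      then show ?thesis
        using mod[of m] step[OF below_ge_2[OF m]]
        by (cases "m mod 2 ^ r = v") (auto simp: level_def below_def H_def)
    next
      assume "m \<in> H k"
      then show ?thesis
        using hit[of m k] a_below_r[of m k] below_ge_2[of m r k]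
        by (auto simp: H_def level_def split: if_splits)
    qed
  qed
  have H: "a m = Suc i \<and> a (m div 2) = i" if "m \<in> H i" for m i
    using that a_below_r[of m i] by (auto simp: H_def below_def split: if_splits)
  have disj: "level j (Suc k) \<inter> H (Suc k) = {}"
    using H[of _ "Suc k"] by (auto simp: level_def)
  have disj': "below j (Suc k) \<inter> H k = {}"
    using H[of _ k] by (auto simp: below_def)
  have sum: "recip summable_on level j (Suc k)" "recip summable_on below j (Suc k)"
    "recip summable_on H i" for i
    using recip_summable_on[OF assms(2), of "level j (Suc k)" "Suc k"]
      recip_summable_on_below[OF assms(2)]
    by (auto simp: H_def level_def)
  have "infsum recip (level j (Suc k)) + infsum recip (H (Suc k))
      = infsum recip (below j (Suc k)) + infsum recip (H k)"
    using infsum_Un_disjoint[OF sum(1,3) disj] infsum_Un_disjoint[OF sum(2,3) disj'] eq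
    by simp
  then show ?thesis by (auto simp: H_def)
qed

lemma level_halving:
  assumes "j < r"
  shows "(\<lambda>k. infsum recip (level (Suc j) k) - infsum recip (level j k) / 2) \<longlonglongrightarrow> 0"
proof (rule LIMSEQ_imp_Suc, rule Lim_null_comparison)
  let ?D = "\<lambda>k. infsum recip (below r k)"
  let ?e = "\<lambda>k. \<Sum>\<^sub>\<infinity>n | a n = k. 1 / real n ^ 2"
  have r: "r \<ge> 1" using assms by simp
  have "(\<lambda>k. ?e (Suc k) + \<bar>?D k - ?D (Suc k)\<bar>) \<longlonglongrightarrow> 0 + \<bar>ln 2 - ln 2\<bar>"
    by (intro tendsto_intros hits_limit[OF r] LIMSEQ_Suc[OF hits_limit[OF r]]
        LIMSEQ_Suc[OF fibre_sums_of_squares_tendsto_0])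
  then show "(\<lambda>k. ?e (Suc k) + \<bar>?D k - ?D (Suc k)\<bar>) \<longlonglongrightarrow> 0" by simp
  show "\<forall>\<^sub>F k in sequentially.
      norm (infsum recip (level (Suc j) (Suc k)) - infsum recip (level j (Suc k)) / 2)
      \<le> ?e (Suc k) + \<bar>?D k - ?D (Suc k)\<bar>"
    using eventually_gt_at_top[of "a 1"]
  proof eventually_elim
    case (elim k)
    then have "a 1 \<noteq> Suc k" by simp
    then show ?case
      using level_vs_below[of "Suc j" k] below_half_level[OF assms, of "Suc k"] assms r
      by (auto split: if_splits)
  qed
qed

text \<open>
  At \<open>j = r\<close> the set \<open>level r (Suc k)\<close> consists of the hits that produce the count \<open>Suc k\<close>; each
  step down in \<open>j\<close> doubles the limit by \<open>level_halving\<close>.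
\<close>

lemma level_limit:
  assumes "j \<le> r" "r \<ge> 1"
  shows "(\<lambda>k. infsum recip (level j k)) \<longlonglongrightarrow> 2 ^ (r - j) * ln 2"
  using assms(1)
proof (induction rule: inc_induct)
  case base
  have "\<forall>\<^sub>F k in sequentially. infsum recip (below r k) = infsum recip (level r (Suc k))"
    using eventually_gt_at_top[of "a 1"]
  proof eventually_elim
    case (elim k)
    then have "a 1 \<noteq> Suc k" by simp
    then show ?case
      using level_vs_below[of r k] assms(2) v_less by simp
  qed
  with hits_limit[OF assms(2)]
  have "(\<lambda>k. infsum recip (level r (Suc k))) \<longlonglongrightarrow> ln 2"
    by (rule Lim_transform_eventually)
  then show ?case by (simp add: LIMSEQ_imp_Suc)
next
  case (step j)
  have "(\<lambda>k. 2 * (infsum recip (level (Suc j) k)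
      - (infsum recip (level (Suc j) k) - infsum recip (level j k) / 2)))
      \<longlonglongrightarrow> 2 * (2 ^ (r - Suc j) * ln 2 - 0)"
    by (intro tendsto_intros step.IH level_halving step.hyps)
  moreover have "2 * 2 ^ (r - Suc j) = (2::real) ^ (r - j)"
    using step.hyps by (simp flip: power_Suc add: Suc_diff_Suc)
  ultimately show ?case by (simp add: mult.assoc[symmetric])
qed

end

theorem theorem3:
  fixes r :: nat and w :: "nat list"
  assumes "r \<ge> 1" and "set w \<subseteq> {0, 1}" and "length w = r"
  shows "(\<forall>k. (\<lambda>n. 1 / real n) summable_on {n. n \<ge> 1 \<and> block_count w n = k}) \<and>
    (\<lambda>k. \<Sum>\<^sub>\<infinity>n\<in>{n. n \<ge> 1 \<and> block_count w n = k}. 1 / real n)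
      \<longlonglongrightarrow> 2 ^ r * ln 2"
proof -
  interpret residue_counter "block_count w" r "bin_value w"
  proof
    have "w \<noteq> []" using assms by auto
    then show "block_count w m = block_count w (m div 2) + (if m mod 2 ^ r = bin_value w then 1 else 0)"
      if "m \<ge> 2" for m
      using block_count_step[OF assms(2) _ that] assms(3) by simp
    show "bin_value w < 2 ^ r"
      using bin_value_less[OF assms(2)] assms(3) by simp
  qed
  have "level 0 k = {n. n \<ge> 1 \<and> block_count w n = k}" for k
    by (auto simp: level_def)
  then show ?thesis
    using recip_summable_on_level[of 0] level_limit[of 0] assms(1) by auto
qed

end
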